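(* There is a sequence of natural numbers $(G_n)_{n\ge0}$ such that for all $n\ge0$ $$d_n=\frac{G_n}{(n+1)!}\prod_{k=1}^n(2^k-1)^{-1}.$$
   Context: The rational numbers $d_n$ ($n\ge0$) are the coefficients of the power series $f(x)=\sum_{n\ge0}\frac{d_n}{n!}x^n$ with $f(0)=1$ and $f(2x)=\frac{e^x-1}{x}f(x)$; equivalently they are defined by the recurrence $d_0=1$ and $(n+1)(2^n-1)d_n=\sum_{k=0}^{n-1}\binom{n+1}{k}d_k$ for $n\ge1$. Empty products equal $1$. *)

theory Defs
  imports "HOL-Computational_Algebra.Formal_Power_Series"
begin

fun dseq :: "nat \<Rightarrow> rat" where
  "dseq 0 = 1"
| "dseq (Suc n) =
     (\<Sum>k\<le>n. of_nat (Suc (Suc n) choose k) * dseq k) /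
     (of_nat (Suc (Suc n)) * (2 ^ Suc n - 1))"

lemma dseq_recurrence:
  "of_nat (n + 1) * (2 ^ n - 1) * dseq n = (\<Sum>k<n. of_nat ((n + 1) choose k) * dseq k)"
proof (cases n)
  case 0
  then show ?thesis by simp
next
  case (Suc m)
  have "(1::rat) < 2 ^ Suc m"
    by (rule one_less_power) auto
  then have "2 ^ Suc m - 1 \<noteq> (0::rat)"
    by linarith
  moreover have "of_nat (Suc (Suc m)) \<noteq> (0::rat)"
    by (simp only: of_nat_eq_0_iff)
  ultimately show ?thesis
    by (simp add: Suc lessThan_Suc_atMost del: of_nat_Suc power_Suc binomial_Suc_Suc right_minus_eq)
qed

text \<open>
  For \<open>f(x) = (\<Sum>n. c n / fact n * x ^ n)\<close>, the functional equation
  \<open>f(2x) = (exp x - 1)/x * f(x)\<close> is equivalent to the recurrence for \<open>c\<close>; together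
  with \<open>f(0) = 1\<close> it therefore characterises \<^const>\<open>dseq\<close>.
\<close>

lemma fps_functional_equation_iff:
  fixes c :: "nat \<Rightarrow> rat"
  defines "f \<equiv> Abs_fps (\<lambda>n. c n / fact n)"
  shows "f oo (fps_const 2 * fps_X) = (fps_exp 1 - 1) / fps_X * f \<longleftrightarrow>
         (\<forall>n. of_nat (n + 1) * (2 ^ n - 1) * c n = (\<Sum>k<n. of_nat ((n + 1) choose k) * c k))"
proof -
  have coeff: "fps_nth ((fps_exp 1 - 1) / fps_X * f) n =
      (c n + (\<Sum>k<n. of_nat ((n + 1) choose k) * c k) / of_nat (n + 1)) / fact n" for n
  proof -
    have "fps_nth ((fps_exp 1 - 1) / fps_X * f) n = fps_nth (f * ((fps_exp 1 - 1) / fps_X)) n"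
      by (simp only: mult.commute)
    also have "\<dots> = (\<Sum>k\<le>n. c k / fact k * (1 / fact (n + 1 - k)))"
      by (simp add: fps_mult_nth f_def atLeast0AtMost Suc_diff_le del: fact_Suc)
    also have "\<dots> = (\<Sum>k\<le>n. of_nat ((n + 1) choose k) * c k / fact (n + 1))"
      by (intro sum.cong refl) (simp add: binomial_fact del: fact_Suc of_nat_Suc)
    also have "\<dots> = (\<Sum>k\<le>n. of_nat ((n + 1) choose k) * c k) / fact (n + 1)"
      by (simp only: sum_divide_distrib)
    also have "(\<Sum>k\<le>n. of_nat ((n + 1) choose k) * c k) =
        (\<Sum>k<n. of_nat ((n + 1) choose k) * c k) + of_nat (n + 1) * c n"
      by (simp add: lessThan_Suc_atMost[symmetric] del: of_nat_Suc binomial_Suc_Suc)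
    also have "\<dots> / fact (n + 1) =
        (c n + (\<Sum>k<n. of_nat ((n + 1) choose k) * c k) / of_nat (n + 1)) / fact n"
      by (simp add: divide_simps del: binomial_Suc_Suc)
    finally show ?thesis .
  qed
  have "f oo (fps_const 2 * fps_X) = (fps_exp 1 - 1) / fps_X * f \<longleftrightarrow>
      (\<forall>n. 2 ^ n * c n / fact n =
           (c n + (\<Sum>k<n. of_nat ((n + 1) choose k) * c k) / of_nat (n + 1)) / fact n)"
    unfolding fps_eq_iff coeff by (simp add: fps_compose_linear f_def)
  also have "\<dots> \<longleftrightarrow>
      (\<forall>n. of_nat (n + 1) * (2 ^ n - 1) * c n = (\<Sum>k<n. of_nat ((n + 1) choose k) * c k))"
  proof (intro all_cong1)
    fix n
    have "of_nat (n + 1) \<noteq> (0::rat)"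
      by (simp only: of_nat_eq_0_iff)
    then show "(2 ^ n * c n / fact n =
           (c n + (\<Sum>k<n. of_nat ((n + 1) choose k) * c k) / of_nat (n + 1)) / fact n) \<longleftrightarrow>
         of_nat (n + 1) * (2 ^ n - 1) * c n = (\<Sum>k<n. of_nat ((n + 1) choose k) * c k)"
      by (simp add: field_simps del: of_nat_Suc of_nat_add binomial_Suc_Suc)
  qed
  finally show ?thesis .
qed

lemma dseq_unique:
  fixes c :: "nat \<Rightarrow> rat"
  assumes "c 0 = 1"
    and rec: "\<And>n. of_nat (n + 1) * (2 ^ n - 1) * c n = (\<Sum>k<n. of_nat ((n + 1) choose k) * c k)"
  shows "c = dseq"
proof
  fix n
  show "c n = dseq n"
  proof (induction n rule: less_induct)
    case (less n)
    show ?case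
    proof (cases "n = 0")
      case True
      then show ?thesis using assms(1) by simp
    next
      case False
      have "(1::rat) < 2 ^ n"
        using False by (intro one_less_power) auto
      moreover have "of_nat (n + 1) \<noteq> (0::rat)"
        by (simp only: of_nat_eq_0_iff)
      moreover have "of_nat (n + 1) * (2 ^ n - 1) * c n = of_nat (n + 1) * (2 ^ n - 1) * dseq n"
        unfolding rec dseq_recurrence using less by (intro sum.cong) auto
      ultimately show ?thesis by simp
    qed
  qed
qed

theorem dseq_iff_fps:
  fixes c :: "nat \<Rightarrow> rat"
  defines "f \<equiv> Abs_fps (\<lambda>n. c n / fact n)"
  shows "c = dseq \<longleftrightarrow>
         fps_nth f 0 = 1 \<and> f oo (fps_const 2 * fps_X) = (fps_exp 1 - 1) / fps_X * f"
  unfolding f_def fps_functional_equation_iff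
  using dseq_unique[of c] dseq_recurrence by auto

end

theory Submission imports Defs begin

text \<open>
  Multiplying the recurrence by \<open>n! \<Prod>j=1..<n. (2 ^ j - 1)\<close> turns its left-hand side into
  \<open>G n\<close> and the \<open>k\<close>-th summand on the right into a natural multiple of \<open>G k\<close>, because
  \<open>(k + 1)!\<close> divides \<open>n!\<close> for \<open>k < n\<close>.
\<close>

lemma sum_in_Nats:
  assumes "\<And>x. x \<in> A \<Longrightarrow> f x \<in> \<nat>"
  shows "sum f A \<in> \<nat>"
  using assms by (induction A rule: infinite_finite_induct) auto

text \<open>Membership in \<nat> replaces a witness for \<open>G n\<close>, so closure under sums
  and products suffices; the sequence is chosen only in the theorem.\<close>

lemma dseq_times_denominator_Nats:
  "dseq n * fact (n + 1) * (\<Prod>k=1..n. 2 ^ k - 1) \<in> \<nat>"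
proof (induction n rule: less_induct)
  case (less n)
  show ?case
  proof (cases n)
    case 0
    then show ?thesis by simp
  next
    case (Suc m)
    have Nats_factor: "(2 ^ j - 1 :: rat) \<in> \<nat>" for j :: nat
    proof -
      \<comment> \<open>Truncated subtraction agrees with the rational one because 1 \<le> 2 ^ j,
        even at j = 0.\<close>
      have "(2 ^ j - 1 :: rat) = of_nat (2 ^ j - 1)"
        by (simp add: of_nat_diff)
      then show ?thesis by (metis of_nat_in_Nats)
    qed
    have Nats_prod: "(\<Prod>j\<in>A. (2 ^ j - 1 :: rat)) \<in> \<nat>" for A :: "nat set"
      by (induction A rule: infinite_finite_induct) (auto intro: Nats_mult Nats_factor)
    have Nats_summand:
      "of_nat ((n + 1) choose k) * dseq k * (fact n * (\<Prod>j=1..m. 2 ^ j - 1)) \<in> \<nat>"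
      if "k < n" for k
    proof -
      have "fact (k + 1) dvd (fact n :: nat)"
        using that by (intro fact_dvd) simp
      then obtain q where "fact n = (fact (k + 1) * q :: nat)" ..
      then have fact_n: "(fact n :: rat) = fact (k + 1) * of_nat q"
        by (metis of_nat_fact of_nat_mult)
      \<comment> \<open>Here k \<le> m since n = m + 1; for k = m the second product is
        empty.\<close>
      have split: "(\<Prod>j=1..m. 2 ^ j - 1 :: rat) = (\<Prod>j=1..k. 2 ^ j - 1) * (\<Prod>j=k+1..m. 2 ^ j - 1)"
        using that Suc prod.ub_add_nat[of 1 k "\<lambda>j. 2 ^ j - 1 :: rat" "m - k"] by simp
      \<comment> \<open>The last bracket is the induction hypothesis at k; the cofactor is visibly
        natural, with q = n!/(k + 1)!.\<close>
      have "of_nat ((n + 1) choose k) * dseq k * (fact n * (\<Prod>j=1..m. 2 ^ j - 1)) =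
          of_nat (((n + 1) choose k) * q) * (\<Prod>j=k+1..m. 2 ^ j - 1) *
          (dseq k * fact (k + 1) * (\<Prod>j=1..k. 2 ^ j - 1))"
        unfolding fact_n split of_nat_mult by (simp only: mult_ac)
      then show ?thesis
        by (simp only:) (intro Nats_mult of_nat_in_Nats Nats_prod less.IH[OF that])
    qed
    \<comment> \<open>Splitting n + 1 off the factorial and the top factor 2 ^ n - 1 off the product
      exposes the left-hand side of the recurrence.\<close>
    have "dseq n * fact (n + 1) * (\<Prod>k=1..n. 2 ^ k - 1) =
        (of_nat (n + 1) * (2 ^ n - 1) * dseq n) * (fact n * (\<Prod>j=1..m. 2 ^ j - 1))"
      by (simp add: Suc mult_ac del: dseq.simps of_nat_Suc power_Suc)
    also have "\<dots> = (\<Sum>k<n. of_nat ((n + 1) choose k) * dseq k * (fact n * (\<Prod>j=1..m. 2 ^ j - 1)))"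
      by (simp only: dseq_recurrence sum_distrib_right)
    also have "\<dots> \<in> \<nat>"
      using Nats_summand by (intro sum_in_Nats) simp
    finally show ?thesis .
  qed
qed

theorem proposition4:
  "\<exists>G :: nat \<Rightarrow> nat. \<forall>n.
     dseq n = of_nat (G n) / fact (n + 1) * (\<Prod>k=1..n. inverse (2 ^ k - 1))"
proof -
  have "\<forall>n. \<exists>g. dseq n * fact (n + 1) * (\<Prod>k=1..n. 2 ^ k - 1) = of_nat g"
    using dseq_times_denominator_Nats by (meson Nats_cases)
  then obtain G where G: "dseq n * fact (n + 1) * (\<Prod>k=1..n. 2 ^ k - 1) = of_nat (G n)" for n
    by metis
  have "dseq n = of_nat (G n) / fact (n + 1) * (\<Prod>k=1..n. inverse (2 ^ k - 1))" for n
  proof -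
    \<comment> \<open>The lower bound k \<ge> 1 matters: the expression vanishes at k = 0.\<close>
    have "(2 ^ k - 1 :: rat) \<noteq> 0" if "k \<in> {1..n}" for k
    proof -
      have "(1::rat) < 2 ^ k"
        using that by (intro one_less_power) auto
      then show ?thesis by simp
    qed
    then have "(\<Prod>k=1..n. 2 ^ k - 1 :: rat) \<noteq> 0"
      by simp
    moreover have "(\<Prod>k=1..n. inverse (2 ^ k - 1 :: rat)) = inverse (\<Prod>k=1..n. 2 ^ k - 1)"
      using prod_inversef[of "\<lambda>k. 2 ^ k - 1 :: rat"] by (simp add: comp_def)
    moreover have "(fact (n + 1) :: rat) \<noteq> 0"
      by (rule fact_nonzero)
    ultimately show ?thesis
      by (simp only: G[symmetric]) (simp add: field_simps del: prod_zero_iff fact_Suc)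
  qed
  then show ?thesis by blast
qed

end
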